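(* Let $h>0$, let $f\in C_0^+(\mathbb{R}^+)$, and assume that the $h$-trimming $\mathrm{Tr}^h(\mathcal{T}_f)$ of the real tree $\mathcal{T}_f$ is not empty. Then: (1) The $h$-cut $f_h$ belongs to $C_0^+(\mathbb{R}^+)$. (2) The $h$-trimming $\mathrm{Tr}^h(\mathcal{T}_f)$ (with the distance $d_f$) is identical, up to a root preserving isometry, to the real tree $(\mathcal{T}_{f_h},d_{f_h})$; that is, there is an isometry from $(\mathrm{Tr}^h(\mathcal{T}_f),d_f)$ onto $(\mathcal{T}_{f_h},d_{f_h})$ mapping the root $\rho_f$ to the root $\rho_{f_h}$.
   Context: $\mathbb{R}^+=[0,\infty)$, and $C_0^+(\mathbb{R}^+)$ is the set of continuous non-negative functions $f$ on $\mathbb{R}^+$ with $f(0)=0$ and compact support. Tree coded by a function. For $f\in C_0^+(\mathbb{R}^+)$ put $d_f(s,t)=f(s)+f(t)-2\inf_{[s\wedge t,s\vee t]}f$ for $s,t\ge 0$, and $s\sim t$ iff $d_f(s,t)=0$. The tree coded by $f$ is the quotient $\mathcal{T}_f=\mathbb{R}^+/\sim$ with the induced distance, still denoted $d_f$; $p_f:\mathbb{R}^+\to\mathcal{T}_f$ is the canonical projection and $\rho_f=p_f(0)$ is the root. The partial order on $\mathcal{T}_f$ is: $v'\preceq v$ ($v'$ is an ancestor of $v$) iff $d_f(v,v')=d_f(\rho_f,v)-d_f(\rho_f,v')$. Trimming. $\mathrm{Tr}^h(\mathcal{T}_f)=\{x\in\mathcal{T}_f:\ \sup_{y\in\mathcal{T}_f,\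 y\succeq x}d_f(x,y)\ge h\}$. It is non-empty iff $\sup_{[0,\infty)}f\ge h$, in which case it contains $\rho_f$, which is taken as its root. Two-sided Skorohod reflection. For a continuous $f:\mathbb{R}^+\to\mathbb{R}$ with $f(0)\in[0,h]$, there is a unique pair of continuous functions $(c^0(f),c^h(f))$ on $\mathbb{R}^+$, both vanishing at $0$, such that: (a) $\Lambda_{0,h}(f):=f+c^0(f)+c^h(f)$ takes values in $[0,h]$; (b) $c^0(f)$ is non-decreasing and $c^h(f)$ is non-increasing; (c) $c^0(f)$ (resp. $c^h(f)$) does not vary off the set $\{t:\Lambda_{0,h}(f)(t)=0\}$ (resp. $\{t:\Lambda_{0,h}(f)(t)=h\}$), i.e. the support of the measure $dc^0(f)$ (resp. $dc^h(f)$) is contained in that set. $h$-cut. For continuous $f$ with $f(0)=0$, $f_h:=f-\Lambda_{0,h}(f)=-c^0(f)-c^h(f)$. *)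

theory Defs
  imports "HOL-Analysis.Analysis"
begin

text \<open>Functions on the half-line are functions of type \<^typ>\<open>real \<Rightarrow> real\<close> of which only the values
  on \<^term>\<open>{0..} :: real set\<close> matter.\<close>

definition C0_plus :: "(real \<Rightarrow> real) set" where
  "C0_plus = {f. continuous_on {0..} f \<and> (\<forall>t\<ge>0. 0 \<le> f t) \<and> f 0 = 0
                 \<and> compact (closure (support_on {0..} f))}"

section \<open>The tree coded by a function\<close>

definition code_dist :: "(real \<Rightarrow> real) \<Rightarrow> real \<Rightarrow> real \<Rightarrow> real" where
  "code_dist f s t = f s + f t - 2 * (INF u\<in>{min s t..max s t}. f u)"

definition code_rel :: "(real \<Rightarrow> real) \<Rightarrow> (real \<times> real) set" where
  "code_rel f = {(s, t). 0 \<le> s \<and> 0 \<le> t \<and> code_dist f s t = 0}"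

definition tree :: "(real \<Rightarrow> real) \<Rightarrow> real set set" where
  "tree f = {0..} // code_rel f"

definition tree_proj :: "(real \<Rightarrow> real) \<Rightarrow> real \<Rightarrow> real set" where
  "tree_proj f t = code_rel f `` {t}"

definition tree_root :: "(real \<Rightarrow> real) \<Rightarrow> real set" where
  "tree_root f = tree_proj f 0"

text \<open>The union below is a singleton when \<^term>\<open>x\<close> and \<^term>\<open>y\<close> are points of the tree coded by
  some \<^term>\<open>f \<in> C0_plus\<close>, since \<^term>\<open>code_dist f\<close> is then constant on pairs of classes.\<close>

definition tree_dist :: "(real \<Rightarrow> real) \<Rightarrow> real set \<Rightarrow> real set \<Rightarrow> real" where
  "tree_dist f x y = the_elem (\<Union>s\<in>x. \<Union>t\<in>y. {code_dist f s t})"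

definition ancestor :: "(real \<Rightarrow> real) \<Rightarrow> real set \<Rightarrow> real set \<Rightarrow> bool" where
  "ancestor f v' v \<longleftrightarrow>
     tree_dist f v v' = tree_dist f (tree_root f) v - tree_dist f (tree_root f) v'"

text \<open>The supremum is that of a non-empty set (it contains \<^term>\<open>tree_dist f x x\<close>), bounded for
  \<^term>\<open>f \<in> C0_plus\<close>.\<close>

definition trimming :: "real \<Rightarrow> (real \<Rightarrow> real) \<Rightarrow> real set set" where
  "trimming h f = {x \<in> tree f. h \<le> (SUP y\<in>{y \<in> tree f. ancestor f x y}. tree_dist f x y)}"

section \<open>Two-sided Skorohod reflection\<close>

definition measure_support :: "'a::topological_space measure \<Rightarrow> 'a set" where
  "measure_support M = {x. \<forall>U. open U \<and> x \<in> U \<longrightarrow> 0 < emeasure M U}"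

text \<open>The Stieltjes measure of a continuous non-decreasing function on the half-line, which is
  extended to negative times by its value at \<open>0\<close>, so that the negative half-line has measure \<open>0\<close>.\<close>

definition stieltjes :: "(real \<Rightarrow> real) \<Rightarrow> real measure" where
  "stieltjes c = interval_measure (\<lambda>t. c (max 0 t))"

text \<open>Since \<open>c\<^sup>h\<close> is non-increasing, the support of \<open>dc\<^sup>h\<close> is by definition that of the positive
  measure \<open>- dc\<^sup>h\<close>. The requirement that both functions be \<^const>\<open>extensional\<close> only fixes their
  irrelevant values at negative times, and makes the pair unique.\<close>

definition skorohod_pair ::
  "real \<Rightarrow> (real \<Rightarrow> real) \<Rightarrow> (real \<Rightarrow> real) \<Rightarrow> (real \<Rightarrow> real) \<Rightarrow> bool" where
  "skorohod_pair h f c0 ch \<longleftrightarrow>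
     c0 \<in> extensional {0..} \<and> ch \<in> extensional {0..} \<and>
     continuous_on {0..} c0 \<and> continuous_on {0..} ch \<and> c0 0 = 0 \<and> ch 0 = 0 \<and>
     (\<forall>t\<ge>0. f t + c0 t + ch t \<in> {0..h}) \<and>
     mono_on {0..} c0 \<and> antimono_on {0..} ch \<and>
     measure_support (stieltjes c0) \<subseteq> {t. 0 \<le> t \<and> f t + c0 t + ch t = 0} \<and>
     measure_support (stieltjes (\<lambda>t. - ch t)) \<subseteq> {t. 0 \<le> t \<and> f t + c0 t + ch t = h}"

definition reflection_terms :: "real \<Rightarrow> (real \<Rightarrow> real) \<Rightarrow> (real \<Rightarrow> real) \<times> (real \<Rightarrow> real)" where
  "reflection_terms h f = (THE (c0, ch). skorohod_pair h f c0 ch)"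

definition reflected :: "real \<Rightarrow> (real \<Rightarrow> real) \<Rightarrow> real \<Rightarrow> real" where
  "reflected h f t = f t + fst (reflection_terms h f) t + snd (reflection_terms h f) t"

definition h_cut :: "real \<Rightarrow> (real \<Rightarrow> real) \<Rightarrow> real \<Rightarrow> real" where
  "h_cut h f t = f t - reflected h f t"

section \<open>Root preserving isometry\<close>

definition rooted_isometry ::
  "'a set \<Rightarrow> ('a \<Rightarrow> 'a \<Rightarrow> real) \<Rightarrow> 'a \<Rightarrow> 'b set \<Rightarrow> ('b \<Rightarrow> 'b \<Rightarrow> real) \<Rightarrow> 'b \<Rightarrow> ('a \<Rightarrow> 'b) \<Rightarrow> bool" where
  "rooted_isometry X d r Y e q \<phi> \<longleftrightarrow>
     bij_betw \<phi> X Y \<and> (\<forall>x\<in>X. \<forall>y\<in>X. e (\<phi> x) (\<phi> y) = d x y) \<and> r \<in> X \<and> \<phi> r = q"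

end

theory Submission
  imports Defs
begin

text \<open>
  The \<open>h\<close>-cut \<open>g\<close> of \<open>f\<close> is a lazy follower of \<open>f\<close>: it stays in the band between \<open>f - h\<close> and
  \<open>f\<close>, moves down only when \<open>f\<close> pushes it from above (reflection at \<open>0\<close>) and up only when \<open>f - h\<close>
  pushes it from below (reflection at \<open>h\<close>). For \<open>f \<ge> 0\<close> with \<open>f 0 = 0\<close> this has an explicit
  solution. A level \<open>r > 0\<close> satisfies \<open>r \<le> g t\<close> exactly if, at some time \<open>s \<le> t\<close>, \<open>f\<close> has reached
  \<open>r + h\<close> and has not gone below \<open>r\<close> between \<open>s\<close> and \<open>t\<close>. In the tree, the ancestor of the point
  \<open>t\<close> at such a level \<open>r\<close> carries a branch of length at least \<open>h\<close>, explored before \<open>t\<close>, so it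
  survives the trimming. This equivalence is the one property of \<open>g\<close> from which everything is
  deduced; it is the axiom of the locale \<open>trimmed_code\<close>.

  The isometry identifies the two trees through the contact times, the times \<open>t\<close> with
  \<open>g t = f t\<close>. Four facts suffice. On contact times the distances coded by \<open>f\<close> and \<open>g\<close> agree
  (\<open>code_dist_contact\<close>): a level that \<open>f\<close> keeps after a contact time is also kept by \<open>g\<close>. Every
  point of the tree of \<open>g\<close> is coded by a contact time (\<open>next_contact\<close>): wait until \<open>f\<close> comes down
  to \<open>g t\<close>. Every point of the trimming is coded by a contact time: wait until the high excursion
  above the point is over. Conversely contact times code points of the trimming
  (\<open>trimming_eq\<close>), where the assumption that the trimming is not empty settles level \<open>0\<close>.

  It remains to see that the \<open>h\<close>-cut defined through the reflection pair is this \<open>g\<close>. Where \<open>f\<close>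
  oscillates by less than \<open>h\<close>, only one of the two barriers can push, so \<open>g\<close> is monotone there
  (\<open>g_monotone_on_small_oscillation\<close>). By uniform continuity a finite mesh consists of such
  intervals, and the increments of \<open>g\<close> along the mesh split into a non-decreasing and a
  non-increasing part, which form a reflection pair (\<open>skorohod_pair_exists\<close>). The pair is unique:
  while the difference of two solutions is positive, the barriers can only diminish it
  (\<open>skorohod_pair_sum_le\<close>); and near any time one of the two terms does not vary, so the solution
  determines both (\<open>skorohod_pair_unique\<close>).
\<close>

section \<open>Points and distances of a coded tree\<close>

lemma C0_plusD:
  assumes "f \<in> C0_plus"
  shows "continuous_on {0..} f" "\<And>t. 0 \<le> t \<Longrightarrow> 0 \<le> f t" "f 0 = 0"
  using assms by (auto simp: C0_plus_def)

lemma C0_plus_vanishes: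
  assumes "f \<in> C0_plus"
  obtains T where "0 < T" "\<And>t. T \<le> t \<Longrightarrow> f t = 0"
proof -
  have "bounded (closure (support_on {0..} f))"
    using assms compact_imp_bounded by (auto simp: C0_plus_def)
  then have "bounded (support_on {0..} f)"
    using bounded_subset closure_subset by blast
  then obtain B where B: "\<And>t. t \<in> support_on {0..} f \<Longrightarrow> norm t \<le> B"
    using bounded_iff by metis
  show thesis
  proof (rule that[of "max 1 (B + 1)"])
    fix t assume "max 1 (B + 1) \<le> t"
    then show "f t = 0"
      using B[of t] by (force simp: support_on_def)
  qed simp
qed

lemma C0_plusI:
  assumes "continuous_on {0..} f" "\<And>t. 0 \<le> t \<Longrightarrow> 0 \<le> f t" "f 0 = 0" "\<And>t. T \<le> t \<Longrightarrow> f t = 0"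
  shows "f \<in> C0_plus"
proof -
  have "support_on {0..} f \<subseteq> {0..T}"
    using assms(4) by (force simp: support_on_def not_le intro: less_imp_le)
  then have "bounded (support_on {0..} f)"
    using bounded_closed_interval bounded_subset by blast
  then show ?thesis
    using assms by (auto simp: C0_plus_def compact_closure)
qed

lemma code_dist_attained:
  assumes "continuous_on {0..} f" "0 \<le> s" "0 \<le> t"
  obtains w where "w \<in> {min s t..max s t}" "\<And>u. u \<in> {min s t..max s t} \<Longrightarrow> f w \<le> f u"
    "code_dist f s t = f s + f t - 2 * f w"
proof -
  have "continuous_on {min s t..max s t} f"
    using assms(2,3) by (intro continuous_on_subset[OF assms(1)]) auto
  then obtain w where w: "w \<in> {min s t..max s t}" "\<forall>u\<in>{min s t..max s t}. f w \<le> f u"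
    using continuous_attains_inf[of "{min s t..max s t}" f] by (metis atLeastAtMost_iff
        compact_Icc empty_iff max.cobounded1 min.cobounded1)
  have "(INF u\<in>{min s t..max s t}. f u) = f w"
    using w by (intro cInf_eq_minimum) auto
  then show thesis
    using w that by (auto simp: code_dist_def)
qed

lemma code_dist_commute: "code_dist f s t = code_dist f t s"
  by (simp add: code_dist_def min.commute max.commute)

lemma code_dist_nonneg:
  assumes "continuous_on {0..} f" "0 \<le> s" "0 \<le> t"
  shows "0 \<le> code_dist f s t"
proof -
  obtain w where w: "\<And>u. u \<in> {min s t..max s t} \<Longrightarrow> f w \<le> f u"
    "code_dist f s t = f s + f t - 2 * f w"
    using code_dist_attained[OF assms] by metis
  show ?thesis
    using w(1)[of s] w(1)[of t] w(2) by auto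
qed

lemma code_dist_self: "code_dist f t t = 0"
  by (simp add: code_dist_def)

lemma code_dist_triangle:
  assumes f: "continuous_on {0..} f" and "0 \<le> s" "0 \<le> t" "0 \<le> u"
  shows "code_dist f s t \<le> code_dist f s u + code_dist f u t"
proof -
  obtain w where w: "w \<in> {min s t..max s t}" "code_dist f s t = f s + f t - 2 * f w"
    using code_dist_attained[of f s t] assms by metis
  obtain w1 where w1: "\<And>v. v \<in> {min s u..max s u} \<Longrightarrow> f w1 \<le> f v"
    "code_dist f s u = f s + f u - 2 * f w1"
    using code_dist_attained[of f s u] assms by metis
  obtain w2 where w2: "\<And>v. v \<in> {min u t..max u t} \<Longrightarrow> f w2 \<le> f v"
    "code_dist f u t = f u + f t - 2 * f w2"
    using code_dist_attained[of f u t] assms by metis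
  have "f w1 \<le> f u" "f w2 \<le> f u"
    using w1(1)[of u] w2(1)[of u] by auto
  moreover have "w \<in> {min s u..max s u} \<or> w \<in> {min u t..max u t}"
    using w(1) by (auto simp: min_def max_def split: if_splits)
  then have "f w1 \<le> f w \<or> f w2 \<le> f w"
    using w1(1) w2(1) by blast
  ultimately show ?thesis
    using w(2) w1(2) w2(2) by linarith
qed

text \<open>In the tree this says when the point coded by \<open>t\<close> is an ancestor of the point coded by
  \<open>s\<close>.\<close>

lemma code_dist_eq_diff_iff:
  assumes "continuous_on {0..} f" "0 \<le> s" "0 \<le> t"
  shows "code_dist f s t = f s - f t \<longleftrightarrow> (\<forall>u\<in>{min s t..max s t}. f t \<le> f u)"
proof -
  obtain w where w: "w \<in> {min s t..max s t}" "\<And>u. u \<in> {min s t..max s t} \<Longrightarrow> f w \<le> f u"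
    "code_dist f s t = f s + f t - 2 * f w"
    using code_dist_attained[OF assms] by metis
  have "t \<in> {min s t..max s t}" by auto
  then show ?thesis
    using w by (smt (verit))
qed

lemma equiv_code_rel:
  assumes f: "continuous_on {0..} f"
  shows "equiv {0..} (code_rel f)"
proof (rule equivI)
  show "code_rel f \<subseteq> {0..} \<times> {0..}"
    by (auto simp: code_rel_def)
  show "refl_on {0..} (code_rel f)"
    by (auto simp: refl_on_def code_rel_def code_dist_self)
  show "sym (code_rel f)"
    by (auto simp: sym_def code_rel_def code_dist_commute)
  show "trans (code_rel f)"
  proof (rule transI)
    fix s t u assume "(s, t) \<in> code_rel f" "(t, u) \<in> code_rel f"
    then show "(s, u) \<in> code_rel f"
      using code_dist_triangle[OF f, of s u t] code_dist_nonneg[OF f, of s u]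
      by (auto simp: code_rel_def)
  qed
qed

lemma mem_tree_proj_iff:
  "s \<in> tree_proj f t \<longleftrightarrow> 0 \<le> s \<and> 0 \<le> t \<and> code_dist f t s = 0"
  by (auto simp: tree_proj_def code_rel_def)

lemma tree_eq_image: "tree f = tree_proj f ` {0..}"
  by (auto simp: tree_def quotient_def tree_proj_def)

lemma tree_proj_eq_iff:
  assumes "continuous_on {0..} f" "0 \<le> s" "0 \<le> t"
  shows "tree_proj f s = tree_proj f t \<longleftrightarrow> code_dist f s t = 0"
  using eq_equiv_class_iff[OF equiv_code_rel[OF assms(1)], of s t] assms
  by (auto simp: tree_proj_def code_rel_def)

lemma tree_dist_proj:
  assumes f: "continuous_on {0..} f" and st: "0 \<le> s" "0 \<le> t"
  shows "tree_dist f (tree_proj f s) (tree_proj f t) = code_dist f s t"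
proof -
  have "code_dist f s' t' = code_dist f s t"
    if "s' \<in> tree_proj f s" "t' \<in> tree_proj f t" for s' t'
  proof -
    have nn: "0 \<le> s'" "0 \<le> t'" and z: "code_dist f s s' = 0" "code_dist f t t' = 0"
      using that by (auto simp: mem_tree_proj_iff)
    note tri = code_dist_triangle[OF f]
    show ?thesis
      using tri[of s t s'] tri[of s' t t'] tri[of s' t' s] tri[of s t' t] z st nn
        code_dist_commute[of f s s'] code_dist_commute[of f t t'] by linarith
  qed
  moreover have "s \<in> tree_proj f s" "t \<in> tree_proj f t"
    using st by (auto simp: mem_tree_proj_iff code_dist_self)
  ultimately have "(\<Union>s'\<in>tree_proj f s. \<Union>t'\<in>tree_proj f t. {code_dist f s' t'}) = {code_dist f s t}"
    by blast
  then show ?thesis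
    by (simp add: tree_dist_def)
qed

lemma ancestor_proj_iff:
  assumes f: "f \<in> C0_plus" and st: "0 \<le> s" "0 \<le> t"
  shows "ancestor f (tree_proj f t) (tree_proj f s) \<longleftrightarrow> (\<forall>u\<in>{min s t..max s t}. f t \<le> f u)"
proof -
  note c = C0_plusD(1)[OF f]
  have root: "code_dist f 0 u = f u" if "0 \<le> u" for u
    using code_dist_eq_diff_iff[OF c that, of 0] C0_plusD(2,3)[OF f] that code_dist_commute[of f 0 u]
    by auto
  show ?thesis
    using st by (simp add: ancestor_def tree_root_def tree_dist_proj[OF c] root code_dist_eq_diff_iff[OF c])
qed

text \<open>Being \<open>h\<close> above a level, without going below that level until \<open>t\<close>, is a closed condition on
  the time and the level. This is why suprema over such excursions are attained, both in
  \<^const>\<open>trimming\<close> and in the explicit form of the \<open>h\<close>-cut.\<close>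

lemma high_excursion_limit:
  fixes f :: "real \<Rightarrow> real"
  assumes f: "continuous_on {0..} f" and "0 \<le> h" "0 \<le> t"
    and X: "\<And>n. X n \<in> {0..B}" and r: "r \<longlonglongrightarrow> r0"
    and top: "\<And>n. r n + h \<le> f (X n)"
    and low: "\<And>n u. u \<in> {min (X n) t..max (X n) t} \<Longrightarrow> r n \<le> f u"
  obtains s where "s \<in> {0..B}" "r0 + h \<le> f s" "\<And>u. u \<in> {min s t..max s t} \<Longrightarrow> r0 \<le> f u"
proof -
  have "seq_compact {0..B}"
    by (simp add: compact_imp_seq_compact)
  then obtain s \<phi> where s: "s \<in> {0..B}" "strict_mono \<phi>" "(X \<circ> \<phi>) \<longlonglongrightarrow> s"
    using X by (meson seq_compactE)
  have r': "(\<lambda>n. r (\<phi> n)) \<longlonglongrightarrow> r0"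
    using LIMSEQ_subseq_LIMSEQ[OF r s(2)] by (simp add: o_def)
  have "(\<lambda>n. f (X (\<phi> n))) \<longlonglongrightarrow> f s"
    using continuous_on_tendsto_compose[OF f s(3)] s(1) X by (auto simp: o_def)
  then have sr: "r0 + h \<le> f s"
    using top by (intro LIMSEQ_le[OF tendsto_add[OF r' tendsto_const]]) auto
  have "r0 \<le> f u" if u: "u \<in> {min s t..max s t}" for u
  proof -
    consider "u = s" | "u = t" | "s < u" "u < t" | "t < u" "u < s"
      using u by (fastforce simp: min_def max_def split: if_splits)
    then show ?thesis
    proof cases
      case 1 then show ?thesis using sr \<open>0 \<le> h\<close> by simp
    next
      case 2
      have "\<And>n. r (\<phi> n) \<le> f t" by (rule low) auto
      then show ?thesis using 2 LIMSEQ_le_const2[OF r'] by blast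
    next
      case 3
      have "eventually (\<lambda>n. X (\<phi> n) < u) sequentially"
        using order_tendstoD(2)[OF s(3) 3(1)] by (simp add: o_def)
      then have "eventually (\<lambda>n. r (\<phi> n) \<le> f u) sequentially"
        by eventually_elim (rule low, use 3 in auto)
      then show ?thesis
        using tendsto_upperbound[OF r'] by simp
    next
      case 4
      have "eventually (\<lambda>n. u < X (\<phi> n)) sequentially"
        using order_tendstoD(1)[OF s(3) 4(2)] by (simp add: o_def)
      then have "eventually (\<lambda>n. r (\<phi> n) \<le> f u) sequentially"
        by eventually_elim (rule low, use 4 in auto)
      then show ?thesis
        using tendsto_upperbound[OF r'] by simp
    qed
  qed
  with s sr that show thesis by blast
qed

text \<open>The sequence of levels used with \<open>high_excursion_limit\<close>. The shift by two keeps it positive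
  from the start when \<open>a = b > 0\<close>.\<close>

lemma tendsto_minus_harmonic:
  fixes a b :: real
  shows "(\<lambda>n. a - b / real (Suc (Suc n))) \<longlonglongrightarrow> a"
proof -
  have "(\<lambda>n. b / real (Suc (Suc n))) \<longlonglongrightarrow> 0"
    using LIMSEQ_Suc[OF LIMSEQ_Suc[OF lim_const_over_n[of b]]] .
  from tendsto_diff[OF tendsto_const this, of a] show ?thesis by simp
qed

text \<open>Descendants of the point \<open>t\<close> are the times that can be joined to \<open>t\<close> without going below
  \<open>f t\<close>, and their distance to it is their height above \<open>f t\<close>; compactness of the support turns the
  supremum of these heights into a maximum.\<close>

lemma proj_in_trimming_iff:
  assumes f: "f \<in> C0_plus" and h: "0 < h" and t: "0 \<le> t"
  shows "tree_proj f t \<in> trimming h f \<longleftrightarrow>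
    (\<exists>s\<ge>0. f t + h \<le> f s \<and> (\<forall>u\<in>{min s t..max s t}. f t \<le> f u))"
proof -
  note c = C0_plusD(1)[OF f]
  define S where "S = {s. 0 \<le> s \<and> (\<forall>u\<in>{min s t..max s t}. f t \<le> f u)}"
  have tS: "t \<in> S" using t by (auto simp: S_def)
  have eq: "{y \<in> tree f. ancestor f (tree_proj f t) y} = tree_proj f ` S"
    using ancestor_proj_iff[OF f _ t] by (auto simp: tree_eq_image S_def)
  have d: "tree_dist f (tree_proj f t) (tree_proj f s) = f s - f t" if "s \<in> S" for s
    using that t code_dist_eq_diff_iff[OF c, of s t] tree_dist_proj[OF c, of t s]
      code_dist_commute[of f s t] by (auto simp: S_def)
  have sup: "(SUP y\<in>{y \<in> tree f. ancestor f (tree_proj f t) y}. tree_dist f (tree_proj f t) y)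
      = (SUP s\<in>S. f s - f t)"
    unfolding eq image_image using d by (intro SUP_cong) auto
  have iff: "tree_proj f t \<in> trimming h f \<longleftrightarrow> h \<le> (SUP s\<in>S. f s - f t)"
    using t by (simp add: trimming_def sup) (simp add: tree_eq_image)
  obtain T where T: "0 < T" "\<And>t. T \<le> t \<Longrightarrow> f t = 0"
    using C0_plus_vanishes[OF f] by blast
  show ?thesis
  proof
    assume "tree_proj f t \<in> trimming h f"
    then have hS: "h \<le> (SUP s\<in>S. f s - f t)" using iff by simp
    have "\<exists>s\<in>S. h - h / real (Suc (Suc n)) \<le> f s - f t" for n
    proof (rule ccontr)
      assume "\<not> ?thesis"
      then have "(SUP s\<in>S. f s - f t) \<le> h - h / real (Suc (Suc n))"
        using tS by (intro cSUP_least) (auto simp: not_le intro: less_imp_le)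
      moreover have "0 < h / real (Suc (Suc n))" using h by simp
      ultimately show False using hS by linarith
    qed
    then obtain X where X: "\<And>n. X n \<in> S" "\<And>n. h - h / real (Suc (Suc n)) \<le> f (X n) - f t"
      by metis
    \<comment> \<open>These heights are positive, which confines the times to the support of \<open>f\<close>.\<close>
    have "X n \<in> {0..T}" for n
    proof -
      have "h / real (Suc (Suc n)) < h"
        using h by (simp add: divide_less_eq mult_less_cancel_left1)
      then have "0 < f (X n)"
        using X(2)[of n] C0_plusD(2)[OF f t] by linarith
      then show ?thesis
        using T(2)[of "X n"] X(1)[of n] by (force simp: S_def)
    qed
    moreover have "f t - h / real (Suc (Suc n)) + h \<le> f (X n)" for n
      using X(2)[of n] by linarith
    moreover have "f t - h / real (Suc (Suc n)) \<le> f u" if "u \<in> {min (X n) t..max (X n) t}" for n u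
    proof -
      have "0 \<le> h / real (Suc (Suc n))" using h by simp
      moreover have "f t \<le> f u" using X(1)[of n] that by (auto simp: S_def)
      ultimately show ?thesis by linarith
    qed
    ultimately obtain s where "s \<in> {0..T}" "f t + h \<le> f s"
      "\<And>u. u \<in> {min s t..max s t} \<Longrightarrow> f t \<le> f u"
      using high_excursion_limit[OF c less_imp_le[OF h] t _ tendsto_minus_harmonic[of "f t" h]]
      by metis
    then show "\<exists>s\<ge>0. f t + h \<le> f s \<and> (\<forall>u\<in>{min s t..max s t}. f t \<le> f u)"
      by auto
  next
    assume "\<exists>s\<ge>0. f t + h \<le> f s \<and> (\<forall>u\<in>{min s t..max s t}. f t \<le> f u)"
    then obtain s where s: "s \<in> S" "h \<le> f s - f t"
      by (force simp: S_def)
    have "compact (f ` {0..T})"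
      using c by (intro compact_continuous_image) (auto intro: continuous_on_subset)
    then obtain M where M: "\<And>u. u \<in> {0..T} \<Longrightarrow> f u \<le> M"
      using bounded_imp_bdd_above[OF compact_imp_bounded] by (fastforce simp: bdd_above_def)
    have "f u \<le> M" if "0 \<le> u" for u
      using M[of u] M[of T] T(2)[of u] T(2)[of T] T(1) that by (cases "u \<le> T") auto
    then have "bdd_above ((\<lambda>s. f s - f t) ` S)"
      by (intro bdd_aboveI2[where M = "M - f t"]) (auto simp: S_def)
    then show "tree_proj f t \<in> trimming h f"
      using s unfolding iff by (intro cSUP_upper2)
  qed
qed

text \<open>Since \<open>f\<close> eventually vanishes, it meets every non-negative level below its present value; at
  the first such time it has not yet been below that level.\<close>

lemma first_descent:
  assumes f: "f \<in> C0_plus" and "0 \<le> s" "0 \<le> r" "r \<le> f s"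
  obtains t where "s \<le> t" "f t = r" "\<And>u. u \<in> {s..t} \<Longrightarrow> r \<le> f u"
proof -
  obtain T where T: "0 < T" "\<And>t. T \<le> t \<Longrightarrow> f t = 0"
    using C0_plus_vanishes[OF f] by blast
  define Z where "Z = {u \<in> {s..s + T}. f u = r}"
  have cont: "continuous_on {s..v} f" for v
    using C0_plusD(1)[OF f] assms(2) by (auto intro: continuous_on_subset)
  have "f (s + T) \<le> r"
    using T(2)[of "s + T"] assms by simp
  then have "Z \<noteq> {}"
    using IVT2'[of f "s + T" r s] cont assms T by (auto simp: Z_def)
  moreover have "compact Z"
  proof -
    have "closed Z"
      unfolding Z_def by (rule continuous_closed_preimage_constant[OF cont closed_atLeastAtMost])
    moreover have "Z = {s..s + T} \<inter> Z"
      by (auto simp: Z_def)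
    ultimately show ?thesis
      using compact_Int_closed[OF compact_Icc] by metis
  qed
  ultimately obtain t where t: "t \<in> Z" "\<And>u. u \<in> Z \<Longrightarrow> t \<le> u"
    using compact_attains_inf[of Z] by blast
  show thesis
  proof (rule that[of t])
    show "s \<le> t" "f t = r" using t by (auto simp: Z_def)
    fix u assume u: "u \<in> {s..t}"
    show "r \<le> f u"
    proof (rule ccontr)
      assume less: "\<not> r \<le> f u"
      moreover from this obtain v where "s \<le> v" "v \<le> u" "f v = r"
        using IVT2'[of f u r s] cont[of u] assms u by auto
      ultimately show False
        using t(2)[of v] t(1) u less by (cases "v = u") (auto simp: Z_def)
    qed
  qed
qed

section \<open>An explicit form of the cut\<close>

text \<open>Adding \<open>0\<close> to the set makes the supremum that of a non-empty set, and discards the negative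
  levels.\<close>

definition cut_height :: "real \<Rightarrow> (real \<Rightarrow> real) \<Rightarrow> real \<Rightarrow> real" where
  "cut_height h f t =
     Sup (insert 0 {r. \<exists>s. 0 \<le> s \<and> s \<le> t \<and> r + h \<le> f s \<and> (\<forall>u\<in>{s..t}. r \<le> f u)})"

text \<open>The locale is used twice: for \<^const>\<open>cut_height\<close>, to build the reflection pair from it, and
  then for \<^const>\<open>h_cut\<close>, which agrees with it at non-negative times only.\<close>

locale trimmed_code =
  fixes h :: real and f g :: "real \<Rightarrow> real"
  assumes h_pos: "0 < h" and f_code: "f \<in> C0_plus"
    and g_nonneg: "0 \<le> t \<Longrightarrow> 0 \<le> g t"
    and le_g_iff: "0 \<le> t \<Longrightarrow> 0 < r \<Longrightarrow>
      r \<le> g t \<longleftrightarrow> (\<exists>s. 0 \<le> s \<and> s \<le> t \<and> r + h \<le> f s \<and> (\<forall>u\<in>{s..t}. r \<le> f u))"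

lemma trimmed_code_cut_height:
  assumes h: "0 < h" and f: "f \<in> C0_plus"
  shows "trimmed_code h f (cut_height h f)"
proof
  fix t :: real assume t: "0 \<le> t"
  define S where "S = {r. \<exists>s. 0 \<le> s \<and> s \<le> t \<and> r + h \<le> f s \<and> (\<forall>u\<in>{s..t}. r \<le> f u)}"
  have g: "cut_height h f t = Sup (insert 0 S)"
    by (simp add: cut_height_def S_def)
  have bdd: "bdd_above (insert 0 S)"
    unfolding S_def by (rule bdd_aboveI[where M = "max 0 (f t)"]) (auto simp: le_max_iff_disj)
  show "0 \<le> cut_height h f t"
    unfolding g by (rule cSup_upper[OF _ bdd]) simp
  fix r :: real assume r: "0 < r"
  show "r \<le> cut_height h f t \<longleftrightarrow>
    (\<exists>s. 0 \<le> s \<and> s \<le> t \<and> r + h \<le> f s \<and> (\<forall>u\<in>{s..t}. r \<le> f u))"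
  proof
    assume le: "r \<le> cut_height h f t"
    define x where "x = cut_height h f t"
    have x: "0 < x" using le r by (simp add: x_def)
    have "\<exists>s\<in>{0..t}. x - x / real (Suc (Suc n)) + h \<le> f s \<and>
        (\<forall>u\<in>{s..t}. x - x / real (Suc (Suc n)) \<le> f u)" for n
    proof -
      let ?y = "x - x / real (Suc (Suc n))"
      have "?y < x" "0 < ?y"
        using x by (auto simp: divide_less_eq mult_less_cancel_left1)
      moreover from this(1) obtain q where "q \<in> insert 0 S" "?y < q"
        using less_cSup_iff[OF _ bdd, of ?y] unfolding x_def g by blast
      ultimately have "q \<in> S" by auto
      then obtain s where s: "0 \<le> s" "s \<le> t" "q + h \<le> f s" "\<forall>u\<in>{s..t}. q \<le> f u"
        by (auto simp: S_def)
      have "?y \<le> f u" if "u \<in> {s..t}" for u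
        using s(4) that \<open>?y < q\<close> by fastforce
      with s \<open>?y < q\<close> show ?thesis
        by (intro bexI[of _ s]) auto
    qed
    then obtain X where X: "\<And>n. X n \<in> {0..t}"
      "\<And>n. x - x / real (Suc (Suc n)) + h \<le> f (X n)"
      "\<And>n u. u \<in> {X n..t} \<Longrightarrow> x - x / real (Suc (Suc n)) \<le> f u"
      by metis
    have mm: "min (X n) t = X n" "max (X n) t = t" for n
      using X(1)[of n] by auto
    obtain s where s: "s \<in> {0..t}" "x + h \<le> f s" "\<And>u. u \<in> {min s t..max s t} \<Longrightarrow> x \<le> f u"
      using high_excursion_limit[OF C0_plusD(1)[OF f] less_imp_le[OF h] t X(1) tendsto_minus_harmonic[of x x] X(2)]
        X(3) unfolding mm by metis
    then show "\<exists>s. 0 \<le> s \<and> s \<le> t \<and> r + h \<le> f s \<and> (\<forall>u\<in>{s..t}. r \<le> f u)"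
      using le unfolding x_def[symmetric] by (intro exI[of _ s]) force
  next
    assume "\<exists>s. 0 \<le> s \<and> s \<le> t \<and> r + h \<le> f s \<and> (\<forall>u\<in>{s..t}. r \<le> f u)"
    then show "r \<le> cut_height h f t"
      unfolding g by (intro cSup_upper[OF _ bdd]) (simp add: S_def)
  qed
qed (use assms in auto)

context trimmed_code
begin

lemmas f_cont = C0_plusD(1)[OF f_code] and f_nonneg = C0_plusD(2)[OF f_code]
  and f_0 = C0_plusD(3)[OF f_code]

lemma g_le_f: "0 \<le> t \<Longrightarrow> g t \<le> f t"
  using le_g_iff[of t "g t"] g_nonneg[of t] f_nonneg[of t] by (cases "g t = 0") auto

lemma f_le_g_plus_h: "0 \<le> t \<Longrightarrow> f t \<le> g t + h"
  using le_g_iff[of t "f t - h"] g_nonneg[of t] h_pos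
  by (cases "0 < f t - h") (auto intro!: exI[of _ t])

text \<open>A level reached by \<open>g\<close> is not lost as long as \<open>f\<close> stays above it, because the excursion that
  witnesses it can be prolonged.\<close>

lemma g_carried_forward:
  assumes "0 \<le> s" "s \<le> t" "r \<le> g s" "\<And>u. u \<in> {s..t} \<Longrightarrow> r \<le> f u"
  shows "r \<le> g t"
proof (cases "0 < r")
  case True
  then obtain w where w: "0 \<le> w" "w \<le> s" "r + h \<le> f w" "\<forall>u\<in>{w..s}. r \<le> f u"
    using le_g_iff assms by blast
  then have "\<forall>u\<in>{w..t}. r \<le> f u"
    using assms(4) by (metis atLeastAtMost_iff linear)
  then show ?thesis
    using w assms True le_g_iff[of t r] by auto
qed (use g_nonneg[of t] assms in auto)

text \<open>A level gained by \<open>g\<close> in the time interval is due to a peak of \<open>f\<close> in this interval: an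
  earlier peak would have given the level to \<open>g\<close> before.\<close>

lemma g_increase_witness:
  assumes "0 \<le> a" "a \<le> b" "g a < g b"
  obtains s where "s \<in> {a..b}" "g b + h \<le> f s"
proof -
  have pos: "0 < g b" using assms g_nonneg[of a] by simp
  then obtain s where s: "0 \<le> s" "s \<le> b" "g b + h \<le> f s" "\<forall>u\<in>{s..b}. g b \<le> f u"
    using le_g_iff[of b "g b"] assms by auto
  have "a \<le> s"
  proof (rule ccontr)
    assume "\<not> a \<le> s"
    then have "g b \<le> g a"
      using s assms pos le_g_iff[of a "g b"] by auto
    then show False using assms by simp
  qed
  then show thesis using s that by auto
qed

text \<open>The two lemmas that follow give the support conditions for the reflection terms. If \<open>g\<close>
  increased without contact of \<open>f\<close> with \<open>g + h\<close>, then already at the maximum of \<open>f\<close> it would have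
  increased, which requires a higher value of \<open>f\<close>.\<close>

lemma g_le_of_below_ceiling:
  assumes "0 \<le> a" "a \<le> b" "\<And>u. u \<in> {a..b} \<Longrightarrow> f u < g u + h"
  shows "g b \<le> g a"
proof (rule ccontr)
  assume "\<not> g b \<le> g a"
  then obtain w where w: "w \<in> {a..b}" "g b + h \<le> f w"
    using g_increase_witness assms by force
  have "continuous_on {a..b} f"
    using f_cont assms by (auto intro: continuous_on_subset)
  then obtain s where s: "s \<in> {a..b}" "\<And>u. u \<in> {a..b} \<Longrightarrow> f u \<le> f s"
    using continuous_attains_sup[of "{a..b}" f] assms by auto
  have "g a < g s"
    using s(2)[OF w(1)] w(2) assms(3)[OF s(1)] \<open>\<not> g b \<le> g a\<close> by linarith
  then obtain v where "v \<in> {a..s}" "g s + h \<le> f v"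
    using g_increase_witness[of a s] assms s by auto
  then show False
    using s(2)[of v] s(1) assms(3)[OF s(1)] by auto
qed

text \<open>If \<open>f\<close> went below \<open>g a\<close>, it would first come down to this level, which \<open>g\<close> has kept until
  then: a contact of \<open>f\<close> with \<open>g\<close>.\<close>

lemma g_le_of_above_floor:
  assumes "0 \<le> a" "a \<le> b" "\<And>u. u \<in> {a..b} \<Longrightarrow> g u < f u"
  shows "g a \<le> g b"
proof (cases "\<forall>u\<in>{a..b}. g a \<le> f u")
  case True
  then show ?thesis using g_carried_forward[of a b "g a"] assms by auto
next
  case False
  then obtain u where u: "u \<in> {a..b}" "f u < g a" by force
  obtain t where t: "a \<le> t" "f t = g a" "\<And>u. u \<in> {a..t} \<Longrightarrow> g a \<le> f u"
    using first_descent[OF f_code, of a "g a"] assms g_nonneg[of a] g_le_f[of a] by auto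
  have "t \<le> u" using t(3)[of u] u by force
  moreover have "g a \<le> g t" using g_carried_forward[of a t "g a"] t assms by auto
  ultimately show ?thesis using assms(3)[of t] t u by auto
qed

lemma g_oscillation:
  assumes "0 \<le> s" "s \<le> t" "\<And>u v. u \<in> {s..t} \<Longrightarrow> v \<in> {s..t} \<Longrightarrow> \<bar>f u - f v\<bar> \<le> e"
  shows "\<bar>g s - g t\<bar> \<le> e"
proof -
  have "g s - e \<le> g t"
  proof (rule g_carried_forward[OF assms(1,2)])
    show "g s - e \<le> g s" using assms(3)[of s s] assms(2) by auto
    show "g s - e \<le> f u" if "u \<in> {s..t}" for u
      using assms(3)[of s u] g_le_f[of s] that assms(1,2) by (auto simp: abs_le_iff)
  qed
  moreover have "g t \<le> g s + e"
  proof (rule ccontr)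
    assume less: "\<not> ?thesis"
    then have "g s < g t" using assms(3)[of s s] assms(2) by auto
    then obtain w where "w \<in> {s..t}" "g t + h \<le> f w"
      using g_increase_witness assms by metis
    then show False
      using less assms(3)[of w s] f_le_g_plus_h[of s] assms(1,2) by (auto simp: abs_le_iff)
  qed
  ultimately show ?thesis by linarith
qed

lemma g_continuous: "continuous_on {0..} g"
  unfolding continuous_on_iff
proof (intro ballI allI impI)
  fix x e :: real assume x: "x \<in> {0..}" and e: "0 < e"
  obtain d where d: "0 < d" "\<And>y. y \<in> {0..} \<Longrightarrow> dist y x < d \<Longrightarrow> dist (f y) (f x) < e / 4"
    using f_cont x e unfolding continuous_on_iff by (metis divide_pos_pos zero_less_numeral)
  have "dist (g y) (g x) < e" if y: "y \<in> {0..}" "dist y x < d" for y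
  proof -
    have osc: "\<bar>f u - f v\<bar> \<le> e / 2"
      if "u \<in> {min x y..max x y}" "v \<in> {min x y..max x y}" for u v
    proof -
      have "\<bar>f w - f x\<bar> < e / 4" if "w \<in> {min x y..max x y}" for w
        using d(2)[of w] that x y by (auto simp: dist_real_def min_def max_def split: if_splits)
      from this[OF that(1)] this[OF that(2)] show ?thesis by linarith
    qed
    have "\<bar>g (min x y) - g (max x y)\<bar> \<le> e / 2"
      by (rule g_oscillation) (use osc x y in auto)
    then have "\<bar>g y - g x\<bar> \<le> e / 2"
      by (cases "x \<le> y") (simp_all add: min_def max_def abs_minus_commute)
    then show ?thesis using e by (simp add: dist_real_def)
  qed
  then show "\<exists>d>0. \<forall>x'\<in>{0..}. dist x' x < d \<longrightarrow> dist (g x') (g x) < e"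
    using d(1) by blast
qed

lemma g_code: "g \<in> C0_plus"
proof -
  obtain T where T: "0 < T" "\<And>t. T \<le> t \<Longrightarrow> f t = 0"
    using C0_plus_vanishes[OF f_code] by blast
  show ?thesis
  proof (rule C0_plusI[OF g_continuous g_nonneg])
    show "g 0 = 0" using g_le_f[of 0] g_nonneg[of 0] f_0 by simp
    show "g t = 0" if "T \<le> t" for t
      using g_le_f[of t] g_nonneg[of t] T that by force
  qed auto
qed

text \<open>The case distinction is whether the minimum of \<open>f\<close> on the interval is at least \<open>g a\<close>. If it
  is, \<open>g\<close> can only be pushed up, and only to levels below this minimum, so that it never meets \<open>f\<close>
  on its way down. If it is not, \<open>g\<close> never sinks below the minimum of \<open>f\<close>, which is above
  \<open>max f - h\<close>, so it is never pushed up.\<close>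

lemma g_monotone_on_small_oscillation:
  assumes "0 \<le> a" and osc: "\<And>u v. u \<in> {a..b} \<Longrightarrow> v \<in> {a..b} \<Longrightarrow> f u - f v < h"
  shows "mono_on {a..b} g \<or> antimono_on {a..b} g"
proof (cases "\<forall>v\<in>{a..b}. g a \<le> f v")
  case True
  have below: "g u \<le> f v" if uv: "u \<in> {a..b}" "v \<in> {a..b}" for u v
  proof (rule ccontr)
    assume less: "\<not> g u \<le> f v"
    then have "g a < g u" using True uv by force
    then obtain w where "w \<in> {a..u}" "g u + h \<le> f w"
      using g_increase_witness[of a u] assms(1) uv by auto
    then show False using less osc[of w v] uv by auto
  qed
  have "mono_on {a..b} g"
  proof (rule mono_onI)
    fix u v assume "u \<in> {a..b}" "v \<in> {a..b}" "u \<le> v"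
    then show "g u \<le> g v"
      using below assms by (intro g_carried_forward[of u v]) auto
  qed
  then show ?thesis ..
next
  case False
  then obtain w where w: "w \<in> {a..b}" "f w < g a" by force
  have "antimono_on {a..b} g"
  proof (rule monotone_onI, rule ccontr)
    fix u v assume uv: "u \<in> {a..b}" "v \<in> {a..b}" "u \<le> v" "\<not> g v \<le> g u"
    then obtain s where s: "s \<in> {u..v}" "g v + h \<le> f s"
      using g_increase_witness[of u v] assms by auto
    have "continuous_on {a..b} f"
      using f_cont assms by (auto intro: continuous_on_subset)
    then obtain m where m: "m \<in> {a..b}" "\<And>u. u \<in> {a..b} \<Longrightarrow> f m \<le> f u"
      using continuous_attains_inf[of "{a..b}" f] w by auto
    have "f m \<le> g a"
      using m(2)[OF w(1)] w(2) by linarith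
    then have "f m \<le> g u"
      using uv m(2) assms by (intro g_carried_forward[of a u]) auto
    then show False using osc[of s m] s uv m by auto
  qed
  then show ?thesis ..
qed

end

section \<open>Uniqueness of the reflection pair\<close>

text \<open>From left to right, every point of an interval that avoids \<open>S\<close> has a null neighbourhood, on
  which \<open>c\<close> is constant; a locally constant function on an interval is constant. From
  right to left, the closedness of \<open>S\<close> leaves room around a point outside \<open>S\<close> for an interval on
  which \<open>c\<close> is flat.\<close>

lemma measure_support_stieltjes_subset_iff:
  assumes mono: "mono_on {0..} c" and cont: "continuous_on {0..} c" and S: "closed S"
  shows "measure_support (stieltjes c) \<subseteq> S \<longleftrightarrow>
    (\<forall>a b. 0 \<le> a \<and> a \<le> b \<and> {a..b} \<inter> S = {} \<longrightarrow> c a = c b)"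
proof -
  define F where "F = (\<lambda>t. c (max 0 t))"
  have F_mono: "F x \<le> F y" if "x \<le> y" for x y
    using that mono by (auto simp: F_def intro!: mono_onD[of "{0..}" c])
  have "continuous_on UNIV F"
    unfolding F_def by (rule continuous_on_compose2[OF cont]) (auto intro!: continuous_intros)
  then have "continuous (at_right x) F" for x
    by (auto simp: continuous_on_eq_continuous_within intro: continuous_within_subset)
  then have meas: "emeasure (stieltjes c) {p<..q} = ennreal (F q - F p)" if "p \<le> q" for p q
    using emeasure_interval_measure_Ioc[OF that, of F] F_mono by (simp add: stieltjes_def F_def)
  have sets: "sets (stieltjes c) = sets borel"
    by (simp add: stieltjes_def)
  show ?thesis
  proof (intro iffI allI impI)
    fix a b assume supp: "measure_support (stieltjes c) \<subseteq> S"
      and ab: "0 \<le> a \<and> a \<le> b \<and> {a..b} \<inter> S = {}"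
    have "\<forall>\<^sub>F y in at x within {a..b}. F x = F y" if x: "x \<in> {a..b}" for x
    proof -
      have "x \<notin> measure_support (stieltjes c)"
        using supp ab x by blast
      then obtain U where U: "open U" "x \<in> U" "emeasure (stieltjes c) U = 0"
        by (auto simp: measure_support_def zero_less_iff_neq_zero)
      obtain e where e: "0 < e" "cball x e \<subseteq> U"
        using U open_contains_cball by blast
      have "{x - e<..x + e} \<subseteq> U"
        using e by (auto simp: dist_real_def subset_iff)
      then have "emeasure (stieltjes c) {x - e<..x + e} \<le> emeasure (stieltjes c) U"
        using U(1) by (intro emeasure_mono) (auto simp: sets)
      then have "F (x + e) \<le> F (x - e)"
        using U(3) meas[of "x - e" "x + e"] e(1) by (simp add: ennreal_eq_0_iff)
      then have const: "F y = F x" if "dist y x < e" for y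
        using that F_mono[of "x - e" y] F_mono[of y "x + e"] F_mono[of "x - e" x]
          F_mono[of x "x + e"] e(1) by (auto simp: dist_real_def abs_less_iff)
      show ?thesis
        unfolding eventually_at using e(1) const by metis
    qed
    then have "F a = F b"
      using ab by (intro connected_local_const[of "{a..b}"]) auto
    then show "c a = c b"
      using ab by (simp add: F_def)
  next
    assume flat: "\<forall>a b. 0 \<le> a \<and> a \<le> b \<and> {a..b} \<inter> S = {} \<longrightarrow> c a = c b"
    show "measure_support (stieltjes c) \<subseteq> S"
    proof (rule subsetI, rule ccontr)
      fix x assume x: "x \<in> measure_support (stieltjes c)" "x \<notin> S"
      obtain d where d: "0 < d" "cball x d \<subseteq> - S"
        using x(2) S open_contains_cball[of "- S"] by (auto simp: open_Compl)
      \<comment> \<open>A neighbourhood of a negative \<open>x\<close> has to stay at negative times, where the measure vanishes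
        even if \<open>S\<close> is not avoided by the times after \<open>0\<close>.\<close>
      define e where "e = (if x < 0 then min d (- x) else d)"
      have e: "0 < e" "e \<le> d" "x < 0 \<Longrightarrow> x + e \<le> 0"
        using d(1) by (auto simp: e_def)
      have "{max 0 (x - e)..max 0 (x + e)} \<inter> S = {}" if "0 \<le> x"
        using that d(2) e by (force simp: dist_real_def subset_iff)
      then have "F (x - e) = F (x + e)"
        using flat e by (cases "0 \<le> x") (auto simp: F_def)
      then have "emeasure (stieltjes c) {x - e<..x + e} = 0"
        using meas[of "x - e" "x + e"] e(1) by simp
      moreover have "emeasure (stieltjes c) {x - e<..<x + e} \<le> emeasure (stieltjes c) {x - e<..x + e}"
        by (intro emeasure_mono) (auto simp: sets)
      ultimately have "emeasure (stieltjes c) {x - e<..<x + e} = 0"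
        by simp
      moreover have "0 < emeasure (stieltjes c) {x - e<..<x + e}"
        using x(1) e(1) unfolding measure_support_def by auto
      ultimately show False by simp
    qed
  qed
qed

text \<open>The support conditions in the form in which they are verified and used below: the terms are
  flat on intervals that stay away from their barrier.\<close>

lemma skorohod_pair_iff:
  assumes f: "continuous_on {0..} f"
  shows "skorohod_pair h f c0 ch \<longleftrightarrow>
     c0 \<in> extensional {0..} \<and> ch \<in> extensional {0..} \<and>
     continuous_on {0..} c0 \<and> continuous_on {0..} ch \<and> c0 0 = 0 \<and> ch 0 = 0 \<and>
     (\<forall>t\<ge>0. f t + c0 t + ch t \<in> {0..h}) \<and>
     mono_on {0..} c0 \<and> antimono_on {0..} ch \<and>
     (\<forall>a b. 0 \<le> a \<and> a \<le> b \<and> (\<forall>t\<in>{a..b}. f t + c0 t + ch t \<noteq> 0) \<longrightarrow> c0 a = c0 b) \<and>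
     (\<forall>a b. 0 \<le> a \<and> a \<le> b \<and> (\<forall>t\<in>{a..b}. f t + c0 t + ch t \<noteq> h) \<longrightarrow> ch a = ch b)"
proof -
  have closed: "closed {t. 0 \<le> t \<and> f t + c0 t + ch t = y}"
    if "continuous_on {0..} c0" "continuous_on {0..} ch" for y
  proof -
    have "continuous_on {0..} (\<lambda>t. f t + c0 t + ch t)"
      using f that by (intro continuous_intros)
    from continuous_closed_preimage_constant[OF this closed_atLeast, of y]
    show ?thesis by simp
  qed
  have mono: "mono_on {0..} (\<lambda>t. - ch t) \<longleftrightarrow> antimono_on {0..} ch"
    by (simp add: monotone_on_def)
  have disj: "{a..b} \<inter> {t. 0 \<le> t \<and> k t = y} = {} \<longleftrightarrow> (\<forall>t\<in>{a..b}. k t \<noteq> y)"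
    if "0 \<le> a" for a b y :: real and k :: "real \<Rightarrow> real"
    using that by auto
  have supp: "measure_support (stieltjes c) \<subseteq> {t. 0 \<le> t \<and> f t + c0 t + ch t = y} \<longleftrightarrow>
      (\<forall>a b. 0 \<le> a \<and> a \<le> b \<and> (\<forall>t\<in>{a..b}. f t + c0 t + ch t \<noteq> y) \<longrightarrow> c a = c b)"
    if "continuous_on {0..} c0" "continuous_on {0..} ch" "continuous_on {0..} c" "mono_on {0..} c"
    for c y
    unfolding measure_support_stieltjes_subset_iff[OF that(4,3) closed[OF that(1,2)]]
    using disj[of _ _ "\<lambda>t. f t + c0 t + ch t" y] by (simp cong: conj_cong)
  have supp0: "measure_support (stieltjes c0) \<subseteq> {t. 0 \<le> t \<and> f t + c0 t + ch t = 0} \<longleftrightarrow>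
      (\<forall>a b. 0 \<le> a \<and> a \<le> b \<and> (\<forall>t\<in>{a..b}. f t + c0 t + ch t \<noteq> 0) \<longrightarrow> c0 a = c0 b)"
    if "continuous_on {0..} c0" "continuous_on {0..} ch" "mono_on {0..} c0"
    using supp[OF that(1,2,1,3)] .
  have supph: "measure_support (stieltjes (\<lambda>t. - ch t)) \<subseteq> {t. 0 \<le> t \<and> f t + c0 t + ch t = h} \<longleftrightarrow>
      (\<forall>a b. 0 \<le> a \<and> a \<le> b \<and> (\<forall>t\<in>{a..b}. f t + c0 t + ch t \<noteq> h) \<longrightarrow> ch a = ch b)"
    if "continuous_on {0..} c0" "continuous_on {0..} ch" "antimono_on {0..} ch"
    using supp[OF that(1,2) continuous_on_minus[OF that(2)]] that(3) by (simp add: mono)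
  show ?thesis
    unfolding skorohod_pair_def by (intro conj_cong refl supp0 supph; assumption)
qed

lemma skorohod_pairD:
  assumes f: "continuous_on {0..} f" and p: "skorohod_pair h f c d"
  shows skorohod_pair_extensional: "c \<in> extensional {0..}" "d \<in> extensional {0..}"
    and skorohod_pair_continuous: "continuous_on {0..} c" "continuous_on {0..} d"
    and skorohod_pair_at_0: "c 0 = 0" "d 0 = 0"
    and skorohod_pair_range: "0 \<le> t \<Longrightarrow> f t + c t + d t \<in> {0..h}"
    and skorohod_pair_mono: "0 \<le> a \<Longrightarrow> a \<le> b \<Longrightarrow> c a \<le> c b" "0 \<le> a \<Longrightarrow> a \<le> b \<Longrightarrow> d b \<le> d a"
    and skorohod_pair_flat:
      "0 \<le> a \<Longrightarrow> a \<le> b \<Longrightarrow> (\<And>t. t \<in> {a..b} \<Longrightarrow> f t + c t + d t \<noteq> 0) \<Longrightarrow> c a = c b"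
      "0 \<le> a \<Longrightarrow> a \<le> b \<Longrightarrow> (\<And>t. t \<in> {a..b} \<Longrightarrow> f t + c t + d t \<noteq> h) \<Longrightarrow> d a = d b"
proof -
  note P = p[unfolded skorohod_pair_iff[OF f]]
  from P show "c \<in> extensional {0..}" "d \<in> extensional {0..}"
    "continuous_on {0..} c" "continuous_on {0..} d" "c 0 = 0" "d 0 = 0"
    by - (elim conjE, assumption)+
  from P have "\<forall>t\<ge>0. f t + c t + d t \<in> {0..h}"
    by (elim conjE)
  then show "0 \<le> t \<Longrightarrow> f t + c t + d t \<in> {0..h}"
    by blast
  from P have "mono_on {0..} c" "antimono_on {0..} d"
    by - (elim conjE, assumption)+
  then show "0 \<le> a \<Longrightarrow> a \<le> b \<Longrightarrow> c a \<le> c b" "0 \<le> a \<Longrightarrow> a \<le> b \<Longrightarrow> d b \<le> d a"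
    by (auto simp: monotone_on_def)
  from P have
    "\<forall>a b. 0 \<le> a \<and> a \<le> b \<and> (\<forall>t\<in>{a..b}. f t + c t + d t \<noteq> 0) \<longrightarrow> c a = c b"
    "\<forall>a b. 0 \<le> a \<and> a \<le> b \<and> (\<forall>t\<in>{a..b}. f t + c t + d t \<noteq> h) \<longrightarrow> d a = d b"
    by - (elim conjE, assumption)+
  then show
    "0 \<le> a \<Longrightarrow> a \<le> b \<Longrightarrow> (\<And>t. t \<in> {a..b} \<Longrightarrow> f t + c t + d t \<noteq> 0) \<Longrightarrow> c a = c b"
    "0 \<le> a \<Longrightarrow> a \<le> b \<Longrightarrow> (\<And>t. t \<in> {a..b} \<Longrightarrow> f t + c t + d t \<noteq> h) \<Longrightarrow> d a = d b"
    by blast+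
qed

text \<open>Suppose that the difference \<open>D\<close> of the two sums is positive at time \<open>t\<close>, and let \<open>a\<close> be the last
  time at which it is half as large. From \<open>a\<close> to \<open>t\<close> the first reflected path lies strictly above the
  second, so that it cannot touch \<open>0\<close> and the second cannot touch \<open>h\<close>. Hence \<open>c\<close> and \<open>d'\<close> are constant
  there, and the monotonicity of \<open>d\<close> and \<open>c'\<close> prevents \<open>D\<close> from growing.\<close>

lemma skorohod_pair_sum_le:
  assumes f: "continuous_on {0..} f"
    and p: "skorohod_pair h f c d" and p': "skorohod_pair h f c' d'" and t: "0 \<le> t"
  shows "c t + d t \<le> c' t + d' t"
proof (rule ccontr)
  note P = skorohod_pairD[OF f p] and P' = skorohod_pairD[OF f p']
  define D where "D u = (c u + d u) - (c' u + d' u)" for u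
  assume "\<not> ?thesis"
  then have pos: "0 < D t" by (simp add: D_def)
  have D0: "D 0 = 0" using P(5,6) P'(5,6) by (simp add: D_def)
  have "continuous_on {0..} D"
    unfolding D_def by (intro continuous_intros P(3,4) P'(3,4))
  then have cont: "continuous_on {u..v} D" if "0 \<le> u" for u v
    using that by (auto intro: continuous_on_subset)
  define Z where "Z = {u \<in> {0..t}. D u = D t / 2}"
  have "Z \<noteq> {}"
    using IVT'[of D 0 "D t / 2" t] cont[of 0 t] D0 pos t by (auto simp: Z_def)
  moreover have "compact Z"
  proof -
    have "closed Z"
      unfolding Z_def by (rule continuous_closed_preimage_constant[OF cont closed_atLeastAtMost]) simp
    moreover have "Z = {0..t} \<inter> Z"
      by (auto simp: Z_def)
    ultimately show ?thesis
      using compact_Int_closed[OF compact_Icc] by metis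
  qed
  ultimately obtain a where a: "a \<in> Z" "\<And>u. u \<in> Z \<Longrightarrow> u \<le> a"
    using compact_attains_sup[of Z] by blast
  have at: "0 \<le> a" "a \<le> t" "D a = D t / 2"
    using a by (auto simp: Z_def)
  have D_pos: "0 < D u" if u: "u \<in> {a..t}" for u
  proof (rule ccontr)
    assume neg: "\<not> 0 < D u"
    then obtain v where "u \<le> v" "v \<le> t" "D v = D t / 2"
      using IVT'[of D u "D t / 2" t] cont[of u t] pos u at by auto
    then show False
      using a(2)[of v] u at neg pos by (cases "v = u") (auto simp: Z_def)
  qed
  have "f u + c u + d u \<noteq> 0 \<and> f u + c' u + d' u \<noteq> h" if "u \<in> {a..t}" for u
  proof -
    have "0 \<le> u" using that at by simp
    then have "f u + c u + d u \<le> h" "0 \<le> f u + c' u + d' u"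
      using P(7)[of u] P'(7)[of u] by auto
    then show ?thesis using D_pos[OF that] by (simp add: D_def)
  qed
  then have "c a = c t" "d' a = d' t"
    using P(10)[OF at(1,2)] P'(11)[OF at(1,2)] by blast+
  moreover have "d t \<le> d a" "c' a \<le> c' t"
    using P(9)[OF at(1,2)] P'(8)[OF at(1,2)] .
  ultimately have "D t \<le> D a"
    by (simp add: D_def)
  then show False using at pos by simp
qed

text \<open>Both pairs have the same sum, hence the same reflected path \<open>L\<close>. As \<open>0 \<noteq> h\<close>, near every time
  \<open>L\<close> avoids one of the barriers. Then \<open>c\<close> and \<open>c'\<close> do not vary, or \<open>d\<close> and \<open>d'\<close> do not; in both
  cases \<open>c - c'\<close> is constant near this time.\<close>

lemma skorohod_pair_unique:
  assumes f: "continuous_on {0..} f" and h: "0 < h"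
    and p: "skorohod_pair h f c d" and p': "skorohod_pair h f c' d'"
  shows "c = c' \<and> d = d'"
proof -
  note P = skorohod_pairD[OF f p] and P' = skorohod_pairD[OF f p']
  have sum: "c t + d t = c' t + d' t" if "0 \<le> t" for t
    using skorohod_pair_sum_le[OF f p p' that] skorohod_pair_sum_le[OF f p' p that] by simp
  define L where "L t = f t + c t + d t" for t
  have L': "f t + c' t + d' t = L t" if "0 \<le> t" for t
    using sum[OF that] by (simp add: L_def)
  have L_cont: "continuous_on {0..} L"
    unfolding L_def by (intro continuous_intros f P(3,4))
  have flat: "c u - c' u = c v - c' v"
    if "0 \<le> u" "u \<le> v" "(\<forall>t\<in>{u..v}. L t \<noteq> 0) \<or> (\<forall>t\<in>{u..v}. L t \<noteq> h)" for u v
    using that(3)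
  proof
    assume L: "\<forall>t\<in>{u..v}. L t \<noteq> 0"
    then have "\<forall>t\<in>{u..v}. f t + c t + d t \<noteq> 0" "\<forall>t\<in>{u..v}. f t + c' t + d' t \<noteq> 0"
      using L' that(1) by (simp_all add: L_def[symmetric])
    then have "c u = c v" "c' u = c' v"
      using P(10)[OF that(1,2)] P'(10)[OF that(1,2)] by blast+
    then show ?thesis by simp
  next
    assume L: "\<forall>t\<in>{u..v}. L t \<noteq> h"
    then have "\<forall>t\<in>{u..v}. f t + c t + d t \<noteq> h" "\<forall>t\<in>{u..v}. f t + c' t + d' t \<noteq> h"
      using L' that(1) by (simp_all add: L_def[symmetric])
    then have "d u = d v" "d' u = d' v"
      using P(11)[OF that(1,2)] P'(11)[OF that(1,2)] by blast+
    then show ?thesis using sum[of u] sum[of v] that by simp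
  qed
  have eq: "c t = c' t" if t: "0 \<le> t" for t
  proof -
    have "\<forall>\<^sub>F y in at x within {0..t}. c x - c' x = c y - c' y" if x: "x \<in> {0..t}" for x
    proof -
      obtain z where z: "z = 0 \<or> z = h" "L x \<noteq> z"
        using h by (metis less_irrefl)
      obtain e where e: "0 < e" "\<And>y. y \<in> {0..} \<Longrightarrow> dist x y < e \<Longrightarrow> L y \<noteq> z"
        using continuous_on_avoid[OF L_cont _ z(2)] x by auto
      have "c x - c' x = c y - c' y" if y: "y \<in> {0..t}" "dist y x < e" for y
      proof -
        have "L w \<noteq> z" if "w \<in> {min x y..max x y}" for w
          using e(2)[of w] that x y by (auto simp: dist_real_def min_def max_def split: if_splits)
        then have "(\<forall>w\<in>{min x y..max x y}. L w \<noteq> 0) \<or> (\<forall>w\<in>{min x y..max x y}. L w \<noteq> h)"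
          using z(1) by blast
        then have "c (min x y) - c' (min x y) = c (max x y) - c' (max x y)"
          using x y by (intro flat) simp_all
        then show ?thesis by (cases "x \<le> y") (auto simp: min_def max_def)
      qed
      then show ?thesis
        unfolding eventually_at using e(1) by blast
    qed
    then have "c 0 - c' 0 = c t - c' t"
      using t by (intro connected_local_const[of "{0..t}"]) auto
    then show ?thesis using P(5) P'(5) by simp
  qed
  have "c = c'"
    using eq by (intro extensionalityI[OF P(1) P'(1)]) simp
  moreover have "d = d'"
    using eq sum by (intro extensionalityI[OF P(2) P'(2)]) force
  ultimately show ?thesis ..
qed

lemma h_cut_eq_of_skorohod_pair:
  assumes f: "continuous_on {0..} f" and h: "0 < h" and p: "skorohod_pair h f c d"
  shows "h_cut h f t = - c t - d t"
proof -
  have "reflection_terms h f = (c, d)"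
    unfolding reflection_terms_def
  proof (rule the_equality)
    show "case (c, d) of (c0, ch) \<Rightarrow> skorohod_pair h f c0 ch" using p by simp
    fix q assume "case q of (c0, ch) \<Rightarrow> skorohod_pair h f c0 ch"
    then show "q = (c, d)"
      using skorohod_pair_unique[OF f h p, of "fst q" "snd q"] by (simp add: case_prod_beta prod_eq_iff)
  qed
  then show ?thesis
    by (simp add: h_cut_def reflected_def)
qed

section \<open>Variation of piecewise monotone functions\<close>

text \<open>If \<open>g\<close> is monotone on each of the \<open>n\<close> mesh intervals of length \<open>d\<close>, then this is its positive
  variation on the interval from \<open>0\<close> to the minimum of \<open>t\<close> and \<open>n d\<close>: clamping \<open>t\<close> to a mesh
  interval makes the summand constant outside it. The negative variation of \<open>g\<close> is the positive
  variation of \<open>- g\<close>.\<close>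

definition positive_variation :: "real \<Rightarrow> nat \<Rightarrow> (real \<Rightarrow> real) \<Rightarrow> real \<Rightarrow> real" where
  "positive_variation d n g t =
     (\<Sum>k<n. max 0 (g (max (real k * d) (min t (real (Suc k) * d))) - g (real k * d)))"

definition monotone_on_mesh :: "real \<Rightarrow> nat \<Rightarrow> (real \<Rightarrow> real) \<Rightarrow> bool" where
  "monotone_on_mesh d n g \<longleftrightarrow> (\<forall>k<n. mono_on {real k * d..real (Suc k) * d} g
     \<or> antimono_on {real k * d..real (Suc k) * d} g)"

lemma monotone_on_mesh_uminus: "monotone_on_mesh d n (\<lambda>t. - g t) \<longleftrightarrow> monotone_on_mesh d n g"
  by (auto simp: monotone_on_mesh_def monotone_on_def)

lemma positive_variation_0: "0 \<le> d \<Longrightarrow> positive_variation d n g 0 = 0"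
  unfolding positive_variation_def
  by (intro sum.neutral ballI) (simp add: min_absorb1 max_absorb1)

lemma positive_variation_continuous:
  assumes d: "0 \<le> d" and g: "continuous_on {0..} g"
  shows "continuous_on {0..} (positive_variation d n g)"
  unfolding positive_variation_def
proof (intro continuous_intros)
  fix k
  show "continuous_on {0..} (\<lambda>t. g (max (real k * d) (min t (real (Suc k) * d))))"
    using d by (intro continuous_on_compose2[OF g] continuous_intros) (auto simp: le_max_iff_disj)
qed

lemma positive_variation_mono:
  assumes d: "0 \<le> d" and g: "monotone_on_mesh d n g"
  shows "mono_on {0..} (positive_variation d n g)"
proof (rule mono_onI)
  fix s t :: real assume st: "s \<le> t"
  show "positive_variation d n g s \<le> positive_variation d n g t"
    unfolding positive_variation_def
  proof (rule sum_mono)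
    fix k assume k: "k \<in> {..<n}"
    define p q where "p = real k * d" and "q = real (Suc k) * d"
    have pq: "p \<le> q" using d by (simp add: p_def q_def mult_right_mono)
    have m: "mono_on {p..q} g \<or> antimono_on {p..q} g"
      using g k by (simp add: monotone_on_mesh_def p_def q_def)
    have in_pq: "max p (min s q) \<in> {p..q}" "max p (min t q) \<in> {p..q}" "p \<in> {p..q}"
      and le: "max p (min s q) \<le> max p (min t q)" "p \<le> max p (min s q)"
      using pq st by auto
    from m have "max 0 (g (max p (min s q)) - g p) \<le> max 0 (g (max p (min t q)) - g p)"
    proof
      assume "mono_on {p..q} g"
      then have "g (max p (min s q)) \<le> g (max p (min t q))"
        using in_pq le by (metis mono_onD)
      then show ?thesis by linarith
    next
      assume "antimono_on {p..q} g"
      then have "g (max p (min s q)) \<le> g p"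
        using in_pq le unfolding monotone_on_def by blast
      then show ?thesis by linarith
    qed
    then show "max 0 (g (max (real k * d) (min s (real (Suc k) * d))) - g (real k * d))
      \<le> max 0 (g (max (real k * d) (min t (real (Suc k) * d))) - g (real k * d))"
      by (simp only: p_def q_def)
  qed
qed

text \<open>On a mesh interval where \<open>g\<close> is non-decreasing, it is constant on the part common with
  \<open>{a..b}\<close>; on the others the summands vanish.\<close>

lemma positive_variation_flat:
  assumes d: "0 \<le> d" and g: "monotone_on_mesh d n g" and ab: "a \<le> b"
    and anti: "antimono_on {a..b} g"
  shows "positive_variation d n g a = positive_variation d n g b"
  unfolding positive_variation_def
proof (rule sum.cong[OF refl])
  fix k assume k: "k \<in> {..<n}"
  define p q where "p = real k * d" and "q = real (Suc k) * d"
  have pq: "p \<le> q" using d by (simp add: p_def q_def mult_right_mono)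
  have m: "mono_on {p..q} g \<or> antimono_on {p..q} g"
    using g k by (simp add: monotone_on_mesh_def p_def q_def)
  define a' b' where "a' = max p (min a q)" and "b' = max p (min b q)"
  have in_pq: "a' \<in> {p..q}" "b' \<in> {p..q}" "p \<in> {p..q}" "p \<le> a'" "p \<le> b'" and le: "a' \<le> b'"
    using pq ab by (auto simp: a'_def b'_def)
  have in_ab: "a' = b' \<or> a' \<in> {a..b} \<and> b' \<in> {a..b}"
    using pq ab by (auto simp: a'_def b'_def min_def max_def)
  from m have "max 0 (g a' - g p) = max 0 (g b' - g p)"
  proof
    assume m: "mono_on {p..q} g"
    have "g a' = g b'"
    proof (cases "a' = b'")
      case False
      then have "g b' \<le> g a'" using in_ab le anti unfolding monotone_on_def by blast
      moreover have "g a' \<le> g b'" using m in_pq le by (metis mono_onD)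
      ultimately show ?thesis by simp
    qed simp
    then show ?thesis by simp
  next
    assume "antimono_on {p..q} g"
    then have "g a' \<le> g p" "g b' \<le> g p"
      using in_pq unfolding monotone_on_def by blast+
    then show ?thesis by simp
  qed
  then show "max 0 (g (max (real k * d) (min a (real (Suc k) * d))) - g (real k * d))
      = max 0 (g (max (real k * d) (min b (real (Suc k) * d))) - g (real k * d))"
    by (simp only: a'_def b'_def p_def q_def)
qed

text \<open>Jordan decomposition: the summands satisfy \<open>max 0 x - max 0 (- x) = x\<close>, and their sum
  telescopes.\<close>

lemma positive_variation_diff:
  assumes d: "0 \<le> d" and t: "0 \<le> t"
  shows "positive_variation d n g t - positive_variation d n (\<lambda>t. - g t) t
    = g (min t (real n * d)) - g 0"
proof (induction n)
  case 0
  then show ?case using t by (simp add: positive_variation_def)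
next
  case (Suc n)
  define p q where "p = real n * d" and "q = real (Suc n) * d"
  have pq: "p \<le> q" using d by (simp add: p_def q_def mult_right_mono)
  have "positive_variation d (Suc n) g t - positive_variation d (Suc n) (\<lambda>t. - g t) t
    = (g (min t p) - g 0) + (max 0 (g (max p (min t q)) - g p) - max 0 (- g (max p (min t q)) + g p))"
    using Suc unfolding positive_variation_def p_def q_def by (simp del: of_nat_Suc)
  also have "\<dots> = g (min t p) + g (max p (min t q)) - g p - g 0"
    by (simp add: max_def)
  also have "\<dots> = g (min t q) - g 0"
    using pq by (cases "t \<le> p") (auto simp: min_def max_def)
  finally show ?case by (simp only: q_def)
qed

section \<open>Existence of the reflection pair\<close>

context trimmed_code
begin

text \<open>The mesh is fine enough that \<open>f\<close> oscillates by less than \<open>h\<close> on its intervals, and it covers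
  the support of \<open>f\<close>. The negative variation of \<open>g\<close> is the push at \<open>0\<close>, its positive variation the
  push at \<open>h\<close>.\<close>

lemma skorohod_pair_exists: "\<exists>c d. skorohod_pair h f c d \<and> (\<forall>t\<ge>0. - c t - d t = g t)"
proof -
  obtain T where T: "0 < T" "\<And>t. T \<le> t \<Longrightarrow> f t = 0"
    using C0_plus_vanishes[OF f_code] by blast
  have "uniformly_continuous_on {0..T} f"
    using f_cont by (intro compact_uniformly_continuous) (auto intro: continuous_on_subset)
  then obtain e where e: "0 < e"
    "\<And>u v. u \<in> {0..T} \<Longrightarrow> v \<in> {0..T} \<Longrightarrow> dist v u < e \<Longrightarrow> dist (f v) (f u) < h"
    using h_pos unfolding uniformly_continuous_on_def by metis
  obtain n :: nat where n: "T / e < real n"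
    using reals_Archimedean2 by blast
  have n0: "0 < real n"
    using n T(1) e(1) by (smt (verit) divide_pos_pos)
  define d where "d = T / real n"
  have d: "0 \<le> d" "d < e" and nd: "real n * d = T"
    using n n0 T(1) e(1) by (auto simp: d_def field_simps)
  have mesh: "monotone_on_mesh d n g"
    unfolding monotone_on_mesh_def
  proof (intro allI impI g_monotone_on_small_oscillation)
    fix k u v assume k: "k < n" and uv: "u \<in> {real k * d..real (Suc k) * d}" "v \<in> {real k * d..real (Suc k) * d}"
    have "real (Suc k) * d \<le> T" "0 \<le> real k * d"
      unfolding nd[symmetric] using k d(1) by (auto intro: mult_right_mono)
    moreover have "dist u v < e"
      using uv d(2) by (auto simp: dist_real_def abs_less_iff algebra_simps)
    ultimately show "f u - f v < h"
      using e(2)[of v u] uv by (auto simp: dist_real_def)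
  qed (use d in auto)
  have mesh': "monotone_on_mesh d n (\<lambda>t. - g t)"
    using mesh by (simp add: monotone_on_mesh_uminus)
  define up down where "up = positive_variation d n g" and "down = positive_variation d n (\<lambda>t. - g t)"
  have g0: "g 0 = 0"
    using g_le_f[of 0] g_nonneg[of 0] f_0 by simp
  have gT: "g t = 0" if "T \<le> t" for t
    using g_le_f[of t] g_nonneg[of t] T that by force
  have diff: "up t - down t = g t" if "0 \<le> t" for t
    using positive_variation_diff[OF d(1) that, of n g] g0 gT[of t] gT[of T]
    unfolding up_def down_def nd by (cases "t \<le> T") (auto simp: min_def)
  have "skorohod_pair h f (restrict down {0..}) (restrict (\<lambda>t. - up t) {0..})"
    unfolding skorohod_pair_iff[OF f_cont]
  proof (intro conjI allI impI)
    have "continuous_on {0..} down"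
      unfolding down_def
      by (rule positive_variation_continuous[OF d(1) continuous_on_minus[OF g_continuous]])
    then show "continuous_on {0..} (restrict down {0..})"
      by (rule continuous_on_eq) simp
    have "continuous_on {0..} (\<lambda>t. - up t)"
      unfolding up_def
      by (rule continuous_on_minus[OF positive_variation_continuous[OF d(1) g_continuous]])
    then show "continuous_on {0..} (restrict (\<lambda>t. - up t) {0..})"
      by (rule continuous_on_eq) simp
    show "f t + restrict down {0..} t + restrict (\<lambda>t. - up t) {0..} t \<in> {0..h}" if "0 \<le> t" for t
      using diff[OF that] g_le_f[OF that] f_le_g_plus_h[OF that] that by simp
    show "mono_on {0..} (restrict down {0..})"
      using positive_variation_mono[OF d(1) mesh'] by (simp add: down_def monotone_on_def)
    show "antimono_on {0..} (restrict (\<lambda>t. - up t) {0..})"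
      using positive_variation_mono[OF d(1) mesh] by (simp add: up_def monotone_on_def)
  next
    fix a b
    assume *: "0 \<le> a \<and> a \<le> b \<and>
      (\<forall>t\<in>{a..b}. f t + restrict down {0..} t + restrict (\<lambda>t. - up t) {0..} t \<noteq> 0)"
    have above: "g u < f u" if u: "u \<in> {a..b}" for u
    proof -
      have "0 \<le> u" using u * by auto
      moreover have "f u + restrict down {0..} u + restrict (\<lambda>t. - up t) {0..} u \<noteq> 0"
        using u * by blast
      ultimately show ?thesis using diff[of u] g_le_f[of u] by simp
    qed
    have "antimono_on {a..b} (\<lambda>t. - g t)"
      using above * by (intro monotone_onI) (auto intro!: g_le_of_above_floor)
    then show "restrict down {0..} a = restrict down {0..} b"
      using positive_variation_flat[OF d(1) mesh', of a b] * by (simp add: down_def)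
  next
    fix a b
    assume *: "0 \<le> a \<and> a \<le> b \<and>
      (\<forall>t\<in>{a..b}. f t + restrict down {0..} t + restrict (\<lambda>t. - up t) {0..} t \<noteq> h)"
    have below: "f u < g u + h" if u: "u \<in> {a..b}" for u
    proof -
      have "0 \<le> u" using u * by auto
      moreover have "f u + restrict down {0..} u + restrict (\<lambda>t. - up t) {0..} u \<noteq> h"
        using u * by blast
      ultimately show ?thesis using diff[of u] f_le_g_plus_h[of u] by simp
    qed
    have "antimono_on {a..b} g"
      using below * by (intro monotone_onI) (auto intro!: g_le_of_below_ceiling)
    then show "restrict (\<lambda>t. - up t) {0..} a = restrict (\<lambda>t. - up t) {0..} b"
      using positive_variation_flat[OF d(1) mesh, of a b] * by (simp add: up_def)
  qed (use positive_variation_0[OF d(1)] in \<open>simp_all add: up_def down_def\<close>)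
  then show ?thesis
    using diff by (intro exI[of _ "restrict down {0..}"] exI[of _ "restrict (\<lambda>t. - up t) {0..}"]) auto
qed

end

lemma trimmed_code_h_cut:
  assumes h: "0 < h" and f: "f \<in> C0_plus"
  shows "trimmed_code h f (h_cut h f)"
proof -
  interpret trimmed_code h f "cut_height h f"
    using trimmed_code_cut_height[OF assms] .
  obtain c d where "skorohod_pair h f c d" "\<And>t. 0 \<le> t \<Longrightarrow> - c t - d t = cut_height h f t"
    using skorohod_pair_exists by blast
  then have eq: "h_cut h f t = cut_height h f t" if "0 \<le> t" for t
    using h_cut_eq_of_skorohod_pair[OF f_cont h] that by simp
  show ?thesis
    using h f g_nonneg le_g_iff by unfold_locales (simp_all add: eq)
qed

section \<open>The isometry\<close>

context trimmed_code
begin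

definition contact_times :: "real set" where
  "contact_times = {t. 0 \<le> t \<and> g t = f t}"

text \<open>The minima of \<open>f\<close> and \<open>g\<close> between the two times coincide: the minimum of \<open>f\<close> is a level that
  \<open>g\<close> has at the earlier time, where it equals \<open>f\<close>, and keeps until the later one.\<close>

lemma code_dist_contact:
  assumes s: "s \<in> contact_times" and t: "t \<in> contact_times"
  shows "code_dist g s t = code_dist f s t"
proof -
  define a b where "a = min s t" and "b = max s t"
  have a: "0 \<le> a" "g a = f a" "a \<le> b" and nn: "0 \<le> s" "0 \<le> t" and eq: "g s = f s" "g t = f t"
    using s t by (auto simp: contact_times_def a_def b_def min_def)
  obtain w where w: "w \<in> {a..b}" "\<And>u. u \<in> {a..b} \<Longrightarrow> f w \<le> f u"
    "code_dist f s t = f s + f t - 2 * f w"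
    using code_dist_attained[OF f_cont nn] unfolding a_def b_def by metis
  obtain v where v: "v \<in> {a..b}" "\<And>u. u \<in> {a..b} \<Longrightarrow> g v \<le> g u"
    "code_dist g s t = g s + g t - 2 * g v"
    using code_dist_attained[OF g_continuous nn] unfolding a_def b_def by metis
  have "f w \<le> g v"
    using w(2) v(1) a by (intro g_carried_forward[of a v]) auto
  moreover have "g v \<le> f w"
    using v(2)[OF w(1)] g_le_f[of w] w(1) a by auto
  ultimately show ?thesis using w(3) v(3) eq by simp
qed

text \<open>The contact time is the first time at which \<open>f\<close> comes down to the level \<open>g t\<close>; until then
  \<open>g\<close> keeps this level, and at that time \<open>f\<close> prevents it from being above.\<close>

lemma next_contact:
  assumes t: "0 \<le> t"
  obtains s where "s \<in> contact_times" "code_dist g t s = 0"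
proof -
  obtain s where s: "t \<le> s" "f s = g t" "\<And>u. u \<in> {t..s} \<Longrightarrow> g t \<le> f u"
    using first_descent[OF f_code t, of "g t"] g_nonneg[OF t] g_le_f[OF t] by auto
  have low: "g t \<le> g u" if "u \<in> {t..s}" for u
    using that s t by (intro g_carried_forward[of t u]) auto
  have gs: "g s = g t"
    using low[of s] g_le_f[of s] s t by auto
  show thesis
  proof (rule that[of s])
    show "s \<in> contact_times" using s t gs by (auto simp: contact_times_def)
    have "code_dist g t s = g t - g s"
      using code_dist_eq_diff_iff[OF g_continuous, of t s] low s t gs by auto
    then show "code_dist g t s = 0" using gs by simp
  qed
qed

lemma tree_g_eq: "tree g = tree_proj g ` contact_times"
proof
  show "tree_proj g ` contact_times \<subseteq> tree g"
    by (auto simp: tree_eq_image contact_times_def)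
  show "tree g \<subseteq> tree_proj g ` contact_times"
  proof
    fix x assume "x \<in> tree g"
    then obtain t where t: "0 \<le> t" "x = tree_proj g t"
      by (auto simp: tree_eq_image)
    obtain s where s: "s \<in> contact_times" "code_dist g t s = 0"
      using next_contact[OF t(1)] .
    then have "x = tree_proj g s"
      using t tree_proj_eq_iff[OF g_continuous t(1), of s] by (auto simp: contact_times_def)
    then show "x \<in> tree_proj g ` contact_times"
      using s by blast
  qed
qed

text \<open>A point of the trimming has a descendant \<open>s\<close> that is \<open>h\<close> higher. The times that code the point
  need not all be contact times: before \<open>s\<close> the cut may not know of the peak yet. After \<open>s\<close> it does,
  so a coding time after \<open>s\<close> is chosen. Conversely the peak that keeps \<open>g\<close> at a positive contact level
  is a descendant of the required height; at level \<open>0\<close> the point is the root, and the maximum of \<open>f\<close>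
  is at least \<open>h\<close> because the trimming has a point.\<close>

lemma trimming_eq:
  assumes "trimming h f \<noteq> {}"
  shows "trimming h f = tree_proj f ` contact_times"
proof
  show "trimming h f \<subseteq> tree_proj f ` contact_times"
  proof
    fix x assume x: "x \<in> trimming h f"
    then obtain t where t: "0 \<le> t" "x = tree_proj f t"
      by (auto simp: trimming_def tree_eq_image)
    then obtain s where s: "0 \<le> s" "f t + h \<le> f s" "\<And>u. u \<in> {min s t..max s t} \<Longrightarrow> f t \<le> f u"
      using x proj_in_trimming_iff[OF f_code h_pos t(1)] by auto
    \<comment> \<open>If the peak precedes \<open>t\<close>, then \<open>t\<close> itself will do.\<close>
    have "\<exists>b\<ge>s. b \<ge> t \<and> f b = f t \<and> (\<forall>u\<in>{min s t..b}. f t \<le> f u)"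
    proof (cases "s \<le> t")
      case True
      then show ?thesis using s by (intro exI[of _ t]) auto
    next
      case False
      obtain b where b: "s \<le> b" "f b = f t" "\<And>u. u \<in> {s..b} \<Longrightarrow> f t \<le> f u"
        using first_descent[OF f_code s(1), of "f t"] f_nonneg[OF t(1)] s(2) h_pos by auto
      have "f t \<le> f u" if "u \<in> {min s t..b}" for u
        using s(3)[of u] b(3)[of u] that by (cases "u \<le> s") auto
      then show ?thesis
        using b False by (intro exI[of _ b]) auto
    qed
    then obtain b where b: "s \<le> b" "t \<le> b" "f b = f t" "\<And>u. u \<in> {min s t..b} \<Longrightarrow> f t \<le> f u"
      by blast
    have "f t \<le> g b"
    proof (cases "f t = 0")
      case False
      then have "0 < f t" using f_nonneg[OF t(1)] by simp
      then show ?thesis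
        using s b by (subst le_g_iff) (auto intro!: exI[of _ s])
    qed (use g_nonneg[of b] b t in auto)
    then have contact: "b \<in> contact_times"
      using g_le_f[of b] b t by (auto simp: contact_times_def)
    have "code_dist f t b = f t - f b"
      using code_dist_eq_diff_iff[OF f_cont t(1), of b] b t by auto
    then have "x = tree_proj f b"
      using tree_proj_eq_iff[OF f_cont t(1), of b] b t by auto
    then show "x \<in> tree_proj f ` contact_times"
      using contact by blast
  qed
  show "tree_proj f ` contact_times \<subseteq> trimming h f"
  proof (rule image_subsetI)
    fix t assume "t \<in> contact_times"
    then have t: "0 \<le> t" "g t = f t" by (auto simp: contact_times_def)
    have "\<exists>s\<ge>0. f t + h \<le> f s \<and> (\<forall>u\<in>{min s t..max s t}. f t \<le> f u)"
    proof (cases "f t = 0")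
      case True
      obtain x where x: "x \<in> trimming h f" using assms by blast
      then obtain t' where t': "0 \<le> t'" "x = tree_proj f t'"
        by (auto simp: trimming_def tree_eq_image)
      then obtain s where s: "0 \<le> s" "f t' + h \<le> f s"
        using x proj_in_trimming_iff[OF f_code h_pos t'(1)] by blast
      then have "h \<le> f s" using f_nonneg[OF t'(1)] by simp
      moreover have "\<forall>u\<in>{min s t..max s t}. f t \<le> f u"
      proof
        fix u assume "u \<in> {min s t..max s t}"
        then have "0 \<le> u" using s(1) t(1) by (auto simp: min_le_iff_disj)
        then show "f t \<le> f u" using f_nonneg True by simp
      qed
      ultimately show ?thesis
        using s(1) True by (intro exI[of _ s]) simp
    next
      case False
      then have "0 < f t" using f_nonneg[OF t(1)] by simp
      then obtain s where "0 \<le> s" "s \<le> t" "f t + h \<le> f s" "\<forall>u\<in>{s..t}. f t \<le> f u"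
        using le_g_iff[of t "f t"] t by auto
      then show ?thesis by (intro exI[of _ s]) auto
    qed
    then show "tree_proj f t \<in> trimming h f"
      using proj_in_trimming_iff[OF f_code h_pos t(1)] by simp
  qed
qed

text \<open>The map sends the point coded by a contact time for \<open>f\<close> to the point coded by the same time
  for \<open>g\<close>; by \<open>code_dist_contact\<close> it does not depend on the choice of this time.\<close>

lemma trimming_isometry:
  assumes "trimming h f \<noteq> {}"
  shows "\<exists>\<phi>. rooted_isometry (trimming h f) (tree_dist f) (tree_root f)
               (tree g) (tree_dist g) (tree_root g) \<phi>"
proof -
  define \<phi> where "\<phi> x = tree_proj g (SOME t. t \<in> x \<and> t \<in> contact_times)" for x
  have nn: "0 \<le> t" if "t \<in> contact_times" for t
    using that by (simp add: contact_times_def)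
  have \<phi>: "\<phi> (tree_proj f t) = tree_proj g t" if t: "t \<in> contact_times" for t
  proof -
    define s where "s = (SOME s. s \<in> tree_proj f t \<and> s \<in> contact_times)"
    have "t \<in> tree_proj f t \<and> t \<in> contact_times"
      using t nn[OF t] by (simp add: mem_tree_proj_iff code_dist_self)
    then have s: "s \<in> tree_proj f t \<and> s \<in> contact_times"
      unfolding s_def by (rule someI)
    then have "code_dist g s t = 0"
      using code_dist_contact[of s t] t by (auto simp: mem_tree_proj_iff code_dist_commute)
    then show ?thesis
      using tree_proj_eq_iff[OF g_continuous, of s t] s t nn by (simp add: \<phi>_def s_def)
  qed
  have dist: "tree_dist g (\<phi> x) (\<phi> y) = tree_dist f x y"
    if "x \<in> trimming h f" "y \<in> trimming h f" for x y
    using that \<phi> nn code_dist_contact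
    by (auto simp: trimming_eq[OF assms] tree_dist_proj[OF f_cont] tree_dist_proj[OF g_continuous])
  have inj: "inj_on \<phi> (trimming h f)"
  proof (rule inj_onI)
    fix x y assume "x \<in> trimming h f" "y \<in> trimming h f" and eq: "\<phi> x = \<phi> y"
    then obtain s t where st: "s \<in> contact_times" "t \<in> contact_times"
      "x = tree_proj f s" "y = tree_proj f t"
      by (auto simp: trimming_eq[OF assms])
    then show "x = y"
      using eq \<phi> nn code_dist_contact[of s t]
      by (simp add: tree_proj_eq_iff[OF f_cont] tree_proj_eq_iff[OF g_continuous])
  qed
  have image: "\<phi> ` trimming h f = tree g"
    using \<phi> by (simp add: trimming_eq[OF assms] tree_g_eq image_image)
  have zero: "0 \<in> contact_times"
    using C0_plusD(3)[OF g_code] f_0 by (simp add: contact_times_def)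
  have "rooted_isometry (trimming h f) (tree_dist f) (tree_root f)
      (tree g) (tree_dist g) (tree_root g) \<phi>"
    unfolding rooted_isometry_def bij_betw_def
  proof (intro conjI ballI inj image dist)
    show "tree_root f \<in> trimming h f"
      using zero by (auto simp: tree_root_def trimming_eq[OF assms])
    show "\<phi> (tree_root f) = tree_root g"
      using \<phi>[OF zero] by (simp add: tree_root_def)
  qed
  then show ?thesis by blast
qed

end

theorem theorem1p2:
  fixes h :: real and f :: "real \<Rightarrow> real"
  assumes "h > 0" and "f \<in> C0_plus" and "trimming h f \<noteq> {}"
  shows "h_cut h f \<in> C0_plus \<and>
         (\<exists>\<phi>. rooted_isometry (trimming h f) (tree_dist f) (tree_root f)
               (tree (h_cut h f)) (tree_dist (h_cut h f)) (tree_root (h_cut h f)) \<phi>)"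
proof -
  interpret trimmed_code h f "h_cut h f"
    using trimmed_code_h_cut assms by blast
  show ?thesis
    using g_code trimming_isometry assms by blast
qed

end
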